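(* Let $m\ge1$, let $\mathbf{p}=(p_i)_{i\in[m]}$ be a probability mass function with $p_i>0$ for all $i$, and let $a>0$. For every connected simple graph $G\in\mathbb{G}_m^{\mathrm{con}}$ and every rooted ordered tree $\mathbf{t}\in\mathbb{T}_m^{\mathrm{ord}}$, $$\mathbb{P}_{\mathrm{con}}(G)\,\nu^{\mathrm{dfs}}(\mathbf{t};G)=\tilde{\mathbb{P}}_{\mathrm{ord}}(\mathbf{t})\,\nu^{\mathrm{per}}(G;\mathbf{t}).$$ In particular, $\mathbb{P}_{\mathrm{con}}(G)=\sum_{\mathbf{t}\in\mathbb{T}_m^{\mathrm{ord}}}\tilde{\mathbb{P}}_{\mathrm{ord}}(\mathbf{t})\,\nu^{\mathrm{per}}(G;\mathbf{t})$.
   Context: $[m]=\{1,\dots,m\}$. $\mathbb{G}_m^{\mathrm{con}}$: connected simple graphs on vertex set $[m]$; $\mathbb{T}_m^{\mathrm{ord}}$: rooted ordered (planar) trees on vertex set $[m]$ (the children of each vertex are linearly ordered). Put $q_{ij}=1-\exp(-ap_ip_j)$. $\mathbb{P}_{\mathrm{con}}$ is the probability on $\mathbb{G}_m^{\mathrm{con}}$ with $\mathbb{P}_{\mathrm{con}}(G)\propto\prod_{(i,j)\in E(G)}q_{ij}\prod_{(i,j)\notin E(G)}(1-q_{ij})$. Randomized depth-first search (rDFS). Given $G\in\mathbb{G}_m^{\mathrm{con}}$, choose the root $v(1)$ at random from the distribution $\mathbf{p}$. Maintain explored vertices $\mathcal{O}(i)$, a vertical stack $\mathcal{A}(i)$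 of active vertices and unexplored vertices $\mathcal{U}(i)=[m]\setminus(\mathcal{A}(i)\cup\mathcal{O}(i))$, with $\mathcal{A}(0)=\{v(1)\}$, $\mathcal{O}(0)=\emptyset$. At step $i\ge1$, let $v(i)$ be the vertex on top of $\mathcal{A}(i-1)$ and $\mathcal{D}(i)=\{u\in\mathcal{U}(i-1):(v(i),u)\in E(G)\}$; delete $v(i)$ from the stack, place the vertices of $\mathcal{D}(i)$ on top of the stack in the order given by an independent uniform random permutation, and add $v(i)$ to the explored set. After $m$ steps this yields a random ordered tree $\Gamma_{\mathbf{p}}(G)\in\mathbb{T}_m^{\mathrm{ord}}$ with root $v(1)$, edges $(v(i),u)$, $u\in\mathcal{D}(i)$, and children ordered by these permutations. $\nu^{\mathrm{dfs}}(\cdot;G)$ is the law of $\Gamma_{\mathbf{p}}(G)$. For $\mathbf{t}\in\mathbb{T}_m^{\mathrm{ord}}$, run the deterministic depth-first search of $\mathbf{t}$ from its root using the order of the children (same stack procedure, no randomization), obtaining $v(i)$, $\mathcal{A}(i)$. The set of permitted edges is $\mathfrak{P}(\mathbf{t})=\{(v(i),j):i\in[m],\ j\in\mathcal{A}(i-1)\setminus\{v(i)\}\}$. Let $\mathbb{G}(\mathbf{t})=\{G\in\mathbb{G}_m^{\mathrm{con}}:E(\mathbf{t})\subset E(G)\subset E(\mathbf{t})\cup\mathfrak{P}(\mathbf{t})\}$ and $$\nu^{\mathrm{per}}(G;\mathbf{t})=\mathbf{1}\{G\in\mathbb{G}(\mathbf{t})\}\prod_{(i,j)\in\mathfrak{P}(\mathbf{t})\cap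 E(G)}q_{ij}\prod_{(i,j)\in\mathfrak{P}(\mathbf{t})\setminus E(G)}(1-q_{ij}).$$ Ordered $\mathbf{p}$-tree law: $\mathbb{P}_{\mathrm{ord}}(\mathbf{t})=\prod_{v\in[m]}p_v^{d_v(\mathbf{t})}/d_v(\mathbf{t})!$, with $d_v(\mathbf{t})$ the number of children of $v$ in $\mathbf{t}$. Let $$L(\mathbf{t})=\prod_{(k,\ell)\in E(\mathbf{t})}\Big[\frac{\exp(ap_kp_\ell)-1}{ap_kp_\ell}\Big]\exp\Big(\sum_{(k,\ell)\in\mathfrak{P}(\mathbf{t})}ap_kp_\ell\Big)$$ and $\tilde{\mathbb{P}}_{\mathrm{ord}}(\mathbf{t})=\mathbb{P}_{\mathrm{ord}}(\mathbf{t})L(\mathbf{t})/\mathbb{E}_{\mathrm{ord}}[L]$, where $\mathbb{E}_{\mathrm{ord}}$ is expectation under $\mathbb{P}_{\mathrm{ord}}$. *)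

theory Defs
  imports "HOL-Probability.Probability" "HOL-Combinatorics.Multiset_Permutations"
begin

text \<open>
  A simple graph on the vertex set \<open>{1..m}\<close> is identified with its edge set, a set of two-element
  subsets of \<open>{1..m}\<close>.
\<close>

definition all_edges :: "nat \<Rightarrow> nat set set" where
  "all_edges m = {{i, j} | i j. i \<in> {1..m} \<and> j \<in> {1..m} \<and> i \<noteq> j}"

definition connected_graphs :: "nat \<Rightarrow> nat set set set" where
  "connected_graphs m =
     {G. G \<subseteq> all_edges m \<and>
         (\<forall>u\<in>{1..m}. \<forall>v\<in>{1..m}. (u, v) \<in> {(x, y). {x, y} \<in> G}\<^sup>*)}"

text \<open>
  A rooted ordered tree is given by its root and, for each vertex, the list of its children in order.
  Non-vertices get the empty list, so that each tree on \<open>{1..m}\<close> has exactly one representation.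
\<close>

datatype otree = OTree (root: nat) (children: "nat \<Rightarrow> nat list")

definition ordered_trees :: "nat \<Rightarrow> otree set" where
  "ordered_trees m =
     {t. root t \<in> {1..m} \<and>
         (\<forall>v. v \<notin> {1..m} \<longrightarrow> children t v = []) \<and>
         (\<forall>v\<in>{1..m}. distinct (children t v) \<and> set (children t v) \<subseteq> {1..m} - {root t}) \<and>
         (\<forall>u\<in>{1..m} - {root t}. \<exists>!v. u \<in> set (children t v)) \<and>
         (\<forall>u\<in>{1..m}. (root t, u) \<in> {(x, y). y \<in> set (children t x)}\<^sup>*)}"

definition tree_edges :: "otree \<Rightarrow> nat set set" where
  "tree_edges t = {{v, u} | v u. u \<in> set (children t v)}"

text \<open>For an edge \<open>e = {i, j}\<close> with \<open>i \<noteq> j\<close> this is \<open>p\<^sub>i p\<^sub>j\<close>.\<close>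

definition edge_mass :: "nat pmf \<Rightarrow> nat set \<Rightarrow> real" where
  "edge_mass p e = (\<Prod>v\<in>e. pmf p v)"

definition edge_prob :: "real \<Rightarrow> nat pmf \<Rightarrow> nat set \<Rightarrow> real" where
  "edge_prob a p e = 1 - exp (- a * edge_mass p e)"

definition graph_weight :: "nat \<Rightarrow> real \<Rightarrow> nat pmf \<Rightarrow> nat set set \<Rightarrow> real" where
  "graph_weight m a p G =
     (\<Prod>e\<in>G. edge_prob a p e) * (\<Prod>e\<in>all_edges m - G. 1 - edge_prob a p e)"

definition P_con :: "nat \<Rightarrow> real \<Rightarrow> nat pmf \<Rightarrow> nat set set \<Rightarrow> real" where
  "P_con m a p G = graph_weight m a p G / (\<Sum>H\<in>connected_graphs m. graph_weight m a p H)"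

text \<open>
  A state of the randomized search consists of the stack of active vertices (head on top), the set
  of explored vertices, and the ordered lists of children recorded so far. An ordering of \<open>D\<close> drawn
  uniformly from all its orderings both determines the new top of the stack (first child on top) and
  is recorded as the list of children. On a connected graph the stack is non-empty during all of the
  \<open>m\<close> steps; the empty case is there for totality only.
\<close>

type_synonym rdfs_state = "nat list \<times> nat set \<times> (nat \<Rightarrow> nat list)"

fun rdfs_step :: "nat \<Rightarrow> nat set set \<Rightarrow> rdfs_state \<Rightarrow> rdfs_state pmf" where
  "rdfs_step m G ([], X, ch) = return_pmf ([], X, ch)"
| "rdfs_step m G (v # A, X, ch) =
     (let U = {1..m} - (set (v # A) \<union> X);
          D = {u \<in> U. {v, u} \<in> G}
      in map_pmf (\<lambda>us. (us @ A, insert v X, ch(v := us))) (pmf_of_set (permutations_of_set D)))"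

primrec rdfs_run :: "nat \<Rightarrow> nat set set \<Rightarrow> nat \<Rightarrow> nat \<Rightarrow> rdfs_state pmf" where
  "rdfs_run m G r 0 = return_pmf ([r], {}, \<lambda>_. [])"
| "rdfs_run m G r (Suc i) = bind_pmf (rdfs_run m G r i) (rdfs_step m G)"

definition rdfs_tree :: "nat \<Rightarrow> nat pmf \<Rightarrow> nat set set \<Rightarrow> otree pmf" where
  "rdfs_tree m p G =
     bind_pmf p (\<lambda>r. map_pmf (\<lambda>(A, X, ch). OTree r ch) (rdfs_run m G r m))"

definition nu_dfs :: "nat \<Rightarrow> nat pmf \<Rightarrow> nat set set \<Rightarrow> otree \<Rightarrow> real" where
  "nu_dfs m p G t = pmf (rdfs_tree m p G) t"

text \<open>
  The stack after \<open>i\<close> steps of the deterministic search of a tree. The unexplored neighbours of the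
  vertex on top are exactly its children, and the first child goes on top, as in the randomized
  search. The explored set is not needed.
\<close>

primrec dfs_stack :: "otree \<Rightarrow> nat \<Rightarrow> nat list" where
  "dfs_stack t 0 = [root t]"
| "dfs_stack t (Suc i) =
     (case dfs_stack t i of [] \<Rightarrow> [] | v # A \<Rightarrow> children t v @ A)"

definition dfs_vertex :: "otree \<Rightarrow> nat \<Rightarrow> nat" where
  "dfs_vertex t i = hd (dfs_stack t (i - 1))"

definition permitted_edges :: "nat \<Rightarrow> otree \<Rightarrow> nat set set" where
  "permitted_edges m t =
     {{dfs_vertex t i, j} | i j. i \<in> {1..m} \<and> j \<in> set (dfs_stack t (i - 1)) - {dfs_vertex t i}}"

definition compatible_graphs :: "nat \<Rightarrow> otree \<Rightarrow> nat set set set" where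
  "compatible_graphs m t =
     {G \<in> connected_graphs m. tree_edges t \<subseteq> G \<and> G \<subseteq> tree_edges t \<union> permitted_edges m t}"

definition nu_per :: "nat \<Rightarrow> real \<Rightarrow> nat pmf \<Rightarrow> otree \<Rightarrow> nat set set \<Rightarrow> real" where
  "nu_per m a p t G =
     (if G \<in> compatible_graphs m t then 1 else 0) *
     (\<Prod>e\<in>permitted_edges m t \<inter> G. edge_prob a p e) *
     (\<Prod>e\<in>permitted_edges m t - G. 1 - edge_prob a p e)"

definition P_ord :: "nat \<Rightarrow> nat pmf \<Rightarrow> otree \<Rightarrow> real" where
  "P_ord m p t =
     (\<Prod>v\<in>{1..m}. pmf p v ^ length (children t v) / fact (length (children t v)))"

definition E_ord :: "nat \<Rightarrow> nat pmf \<Rightarrow> (otree \<Rightarrow> real) \<Rightarrow> real" where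
  "E_ord m p f = (\<Sum>t\<in>ordered_trees m. P_ord m p t * f t)"

definition tilt :: "nat \<Rightarrow> real \<Rightarrow> nat pmf \<Rightarrow> otree \<Rightarrow> real" where
  "tilt m a p t =
     (\<Prod>e\<in>tree_edges t. (exp (a * edge_mass p e) - 1) / (a * edge_mass p e)) *
     exp (\<Sum>e\<in>permitted_edges m t. a * edge_mass p e)"

definition P_ord_tilted :: "nat \<Rightarrow> real \<Rightarrow> nat pmf \<Rightarrow> otree \<Rightarrow> real" where
  "P_ord_tilted m a p t = P_ord m p t * tilt m a p t / E_ord m p (tilt m a p)"

end

theory Submission
  imports Defs
begin

text \<open>
  The identity says that two ways of producing a random pair (graph, tree) agree, and it holds because
  both sides have the same unnormalised density. Fix a connected graph \<open>G\<close> and an ordered tree \<open>t\<close>.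

  The randomized search of \<open>G\<close> produces \<open>t\<close> exactly if it starts at the root of \<open>t\<close> and at each step
  the drawn ordering is the list of children of the current vertex in \<open>t\<close>. As long as that has
  happened, the stacks are those of the deterministic search of \<open>t\<close>, so the next success is possible
  only if the children in \<open>t\<close> are precisely the unexplored neighbours, and then has probability
  \<open>1 / d\<^sub>v!\<close>. Every pair of vertices is met once, at the earlier of its two endpoints; there the other
  endpoint is either on the stack (a permitted pair, on which the condition says nothing) or
  unexplored (a pair that must be an edge of \<open>G\<close> iff it is a tree edge). The conditions at all the
  steps together therefore mean that \<open>G\<close> lies between the tree edges and the tree edges plus the
  permitted ones (\<open>compatible_iff_discovered\<close>), and \<open>nu_dfs\<close> is \<open>p\<^sub>r \<Prod>\<^sub>v 1 / d\<^sub>v!\<close> on those graphs and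
  zero elsewhere (\<open>nu_dfs_eq\<close>).

  For compatible \<open>G\<close> the graph weight splits over tree edges, permitted pairs and the remaining
  pairs. The permitted pairs give \<open>nu_per\<close>. Writing \<open>q\<^sub>e = (exp x\<^sub>e - 1) exp (- x\<^sub>e)\<close> on tree edges and
  \<open>1 - q\<^sub>e = exp (- x\<^sub>e)\<close> on remaining pairs, with \<open>x\<^sub>e = a p\<^sub>i p\<^sub>j\<close>, the rest is the tilting factor up to
  \<open>exp (- \<Sum>\<^sub>e x\<^sub>e)\<close>, which is the same for all trees, and the product of \<open>x\<^sub>e\<close> over tree edges. The latter
  contains \<open>p\<^sub>v\<close> once for each child of \<open>v\<close> and once more for each \<open>v\<close> other than the root; the missing
  \<open>p\<^sub>r\<close> is the probability of the starting vertex. So the graph weight times \<open>nu_dfs\<close> equals a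
  constant times the tilted tree weight times \<open>nu_per\<close> (\<open>graph_weight_nu_dfs\<close>).

  No normalising constant has to be computed. The search of a connected graph always ends in an
  ordered tree, so \<open>nu_dfs\<close> sums to one over trees (\<open>sum_nu_dfs\<close>), and choosing the permitted edges
  independently shows that \<open>nu_per\<close> sums to one over graphs (\<open>sum_nu_per\<close>). Summing the unnormalised
  identity over both variables then identifies the two normalising constants up to the same factor.
\<close>

section \<open>Depth-first search of an ordered tree\<close>

text \<open>
  Stacks and explored sets are indexed by the number of completed steps, vertices by the step that
  processes them; so \<open>dfs_vertex t (Suc i)\<close> is the top of \<open>dfs_stack t i\<close> and not in \<open>explored t i\<close>.
\<close>

definition explored :: "otree \<Rightarrow> nat \<Rightarrow> nat set" where
  "explored t i = dfs_vertex t ` {1..i}"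

lemma explored_0 [simp]: "explored t 0 = {}"
  by (simp add: explored_def)

lemma explored_Suc: "explored t (Suc i) = insert (dfs_vertex t (Suc i)) (explored t i)"
  by (simp add: explored_def atLeastAtMostSuc_conv)

lemma finite_explored [simp]: "finite (explored t i)"
  by (simp add: explored_def)

text \<open>
  The union in the third conjunct says that the vertices found so far are the root and the children of
  the explored vertices. This makes children of the current vertex new, since each of them has
  only one parent, and it makes an empty stack mean that the explored set is closed under children.
\<close>

definition dfs_invariant :: "otree \<Rightarrow> nat \<Rightarrow> bool" where
  "dfs_invariant t i \<longleftrightarrow>
     distinct (dfs_stack t i) \<and> set (dfs_stack t i) \<inter> explored t i = {} \<and>
     set (dfs_stack t i) \<union> explored t i = insert (root t) (\<Union>v\<in>explored t i. set (children t v)) \<and>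
     card (explored t i) = i"

lemma ordered_treesD:
  assumes "t \<in> ordered_trees m"
  shows "root t \<in> {1..m}" "v \<notin> {1..m} \<Longrightarrow> children t v = []" "distinct (children t v)"
    "u \<in> set (children t v) \<Longrightarrow> u \<in> {1..m} \<and> u \<noteq> root t \<and> v \<in> {1..m}"
    "u \<in> set (children t v) \<Longrightarrow> u \<in> set (children t w) \<Longrightarrow> v = w"
    "u \<in> {1..m} \<Longrightarrow> u \<noteq> root t \<Longrightarrow> \<exists>v. u \<in> set (children t v)"
    "u \<in> {1..m} \<Longrightarrow> (root t, u) \<in> {(x, y). y \<in> set (children t x)}\<^sup>*"
proof -
  note T = assms[unfolded ordered_trees_def mem_Collect_eq]
  show "root t \<in> {1..m}" and off: "v \<notin> {1..m} \<Longrightarrow> children t v = []" for v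
    using T by blast+
  show "distinct (children t v)"
    using T off[of v] by (cases "v \<in> {1..m}") auto
  show ch: "u \<in> {1..m} \<and> u \<noteq> root t \<and> v \<in> {1..m}" if "u \<in> set (children t v)" for u v
  proof -
    have "v \<in> {1..m}" using off[of v] that by force
    then show ?thesis using T that by blast
  qed
  show "v = w" if "u \<in> set (children t v)" "u \<in> set (children t w)"
  proof -
    have "u \<in> {1..m} - {root t}" using ch that(1) by blast
    then have "\<exists>!v. u \<in> set (children t v)" using T by blast
    then show ?thesis using that by blast
  qed
  show "\<exists>v. u \<in> set (children t v)" if "u \<in> {1..m}" "u \<noteq> root t"
  proof -
    have "u \<in> {1..m} - {root t}" using that by blast
    then have "\<exists>!v. u \<in> set (children t v)" using T by blast
    then show ?thesis by blast
  qed
  show "(root t, u) \<in> {(x, y). y \<in> set (children t x)}\<^sup>*" if "u \<in> {1..m}"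
    using T that by blast
qed

lemma dfs_invariant_vertices:
  assumes "t \<in> ordered_trees m" "dfs_invariant t i"
  shows "set (dfs_stack t i) \<union> explored t i \<subseteq> {1..m}"
proof -
  have "set (dfs_stack t i) \<union> explored t i = insert (root t) (\<Union>v\<in>explored t i. set (children t v))"
    using assms(2) by (simp add: dfs_invariant_def)
  moreover have "set (children t v) \<subseteq> {1..m}" for v
    using ordered_treesD(4)[OF assms(1)] by auto
  ultimately show ?thesis
    using ordered_treesD(1)[OF assms(1)] by auto
qed

text \<open>
  With an empty stack the explored set contains the root and is closed under children, hence is
  everything, although only \<open>i < m\<close> vertices have been explored.
\<close>

lemma dfs_stack_nonempty:
  assumes t: "t \<in> ordered_trees m" and inv: "dfs_invariant t i" and "i < m"
  shows "dfs_stack t i \<noteq> []"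
proof
  assume "dfs_stack t i = []"
  then have closed: "explored t i = insert (root t) (\<Union>v\<in>explored t i. set (children t v))"
    using inv unfolding dfs_invariant_def by simp
  have "u \<in> explored t i" if "(root t, u) \<in> {(x, y). y \<in> set (children t x)}\<^sup>*" for u
    using that
  proof (induction rule: rtrancl_induct)
    case base
    show ?case using closed by blast
  next
    case (step y z)
    then show ?case using closed by blast
  qed
  then have "{1..m} \<subseteq> explored t i"
    using ordered_treesD(7)[OF t] by blast
  then have "card {1..m} \<le> card (explored t i)"
    by (intro card_mono) auto
  then show False
    using inv \<open>i < m\<close> unfolding dfs_invariant_def by simp
qed

lemma dfs_invariant_children_new:
  assumes t: "t \<in> ordered_trees m" and inv: "dfs_invariant t i"
    and u: "u \<in> set (children t v)" and v: "v \<notin> explored t i"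
  shows "u \<notin> set (dfs_stack t i) \<union> explored t i"
proof
  assume "u \<in> set (dfs_stack t i) \<union> explored t i"
  then consider "u = root t" | x where "x \<in> explored t i" "u \<in> set (children t x)"
    using inv unfolding dfs_invariant_def by blast
  then show False
    using ordered_treesD(4,5)[OF t] u v by cases blast+
qed

lemma dfs_invariant_holds:
  assumes t: "t \<in> ordered_trees m" and "i \<le> m"
  shows "dfs_invariant t i"
  using \<open>i \<le> m\<close>
proof (induction i)
  case 0
  show ?case by (simp add: dfs_invariant_def)
next
  case (Suc i)
  then have inv: "dfs_invariant t i" by simp
  have "dfs_stack t i \<noteq> []"
    using dfs_stack_nonempty[OF t inv] Suc.prems by simp
  then obtain v A where st: "dfs_stack t i = v # A"
    by (cases "dfs_stack t i") auto
  have v: "dfs_vertex t (Suc i) = v"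
    by (simp add: dfs_vertex_def st)
  note I = inv[unfolded dfs_invariant_def st]
  have new: "u \<notin> insert v (set A) \<union> explored t i" if "u \<in> set (children t v)" for u
    using dfs_invariant_children_new[OF t inv that] I st by auto
  have A: "distinct A" "v \<notin> set A" "v \<notin> explored t i" "set A \<inter> explored t i = {}"
      "card (explored t i) = i"
    using I by simp_all
  have frontier: "insert v (set A) \<union> explored t i =
      insert (root t) (\<Union>v\<in>explored t i. set (children t v))"
    using I by simp
  show ?case
    unfolding dfs_invariant_def explored_Suc v
  proof (intro conjI)
    have next_stack: "dfs_stack t (Suc i) = children t v @ A" by (simp add: st)
    show "distinct (dfs_stack t (Suc i))"
      unfolding next_stack using A(1) new ordered_treesD(3)[OF t, of v] by auto
    show "set (dfs_stack t (Suc i)) \<inter> insert v (explored t i) = {}"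
      unfolding next_stack using A new by auto
    have "set (dfs_stack t (Suc i)) \<union> insert v (explored t i) =
        set (children t v) \<union> (insert v (set A) \<union> explored t i)"
      unfolding next_stack by auto
    then show "set (dfs_stack t (Suc i)) \<union> insert v (explored t i) =
        insert (root t) (\<Union>v\<in>insert v (explored t i). set (children t v))"
      unfolding frontier by auto
    show "card (insert v (explored t i)) = Suc i"
      using A by simp
  qed
qed

lemma dfs_stack_Cons:
  assumes t: "t \<in> ordered_trees m" and "i < m"
  obtains A where "dfs_stack t i = dfs_vertex t (Suc i) # A"
proof -
  have "dfs_invariant t i" using dfs_invariant_holds[OF t] \<open>i < m\<close> by simp
  then have "dfs_stack t i \<noteq> []"
    using dfs_stack_nonempty[OF t _ \<open>i < m\<close>] by blast
  then have "dfs_stack t i = dfs_vertex t (Suc i) # tl (dfs_stack t i)"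
    by (simp add: dfs_vertex_def)
  then show thesis by (rule that)
qed

lemma explored_all:
  assumes t: "t \<in> ordered_trees m"
  shows "explored t m = {1..m}"
proof (rule card_subset_eq)
  have inv: "dfs_invariant t m" using dfs_invariant_holds[OF t] by simp
  show "explored t m \<subseteq> {1..m}" using dfs_invariant_vertices[OF t inv] by blast
  show "card (explored t m) = card {1..m}" using inv by (simp add: dfs_invariant_def)
qed simp

text \<open>
  Every step explores a new vertex, and there are as many steps as vertices; so the search order
  enumerates the vertices, and any vertex may be named by its position in it.
\<close>

lemma dfs_vertex_bij_betw:
  assumes t: "t \<in> ordered_trees m"
  shows "bij_betw (\<lambda>i. dfs_vertex t (Suc i)) {..<m} {1..m}"
proof -
  have "bij_betw (dfs_vertex t) {1..m} {1..m}"
    unfolding bij_betw_def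
  proof
    show im: "dfs_vertex t ` {1..m} = {1..m}"
      using explored_all[OF t] unfolding explored_def .
    show "inj_on (dfs_vertex t) {1..m}"
      by (rule eq_card_imp_inj_on) (simp_all only: im finite_atLeastAtMost)
  qed
  moreover have "bij_betw Suc {..<m} {1..m}"
    by (rule bij_betw_byWitness[where f' = "\<lambda>i. i - 1"]) auto
  ultimately show ?thesis
    using bij_betw_trans[of Suc "{..<m}" "{1..m}" "dfs_vertex t" "{1..m}"] by (simp add: comp_def)
qed

lemma explored_alt: "explored t i = (\<lambda>j. dfs_vertex t (Suc j)) ` {..<i}"
  unfolding explored_def by (metis image_Suc_lessThan image_image)

lemma dfs_vertex_explored_iff:
  assumes t: "t \<in> ordered_trees m" and "i \<le> m" "j < m"
  shows "dfs_vertex t (Suc j) \<in> explored t i \<longleftrightarrow> j < i"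
  using bij_betw_imp_inj_on[OF dfs_vertex_bij_betw[OF t]] assms(2,3)
  unfolding explored_alt inj_on_def by fastforce

lemma dfs_vertex_cases:
  assumes t: "t \<in> ordered_trees m" and "u \<in> {1..m}"
  obtains i where "i < m" "u = dfs_vertex t (Suc i)"
  using bij_betw_imp_surj_on[OF dfs_vertex_bij_betw[OF t]] assms(2) by fast

lemma child_later:
  assumes t: "t \<in> ordered_trees m" and "i < m" and u: "u \<in> set (children t (dfs_vertex t (Suc i)))"
  shows "u \<in> {1..m} - (set (dfs_stack t i) \<union> explored t i)"
  using dfs_invariant_children_new[OF t dfs_invariant_holds[OF t] u] dfs_vertex_explored_iff[OF t, of i i]
    ordered_treesD(4)[OF t u] assms(2) by simp

lemma unexplored_later:
  assumes t: "t \<in> ordered_trees m" and i: "i < m"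
    and u: "u \<in> {1..m} - (set (dfs_stack t i) \<union> explored t i)"
  obtains k where "i < k" "k < m" "u = dfs_vertex t (Suc k)"
proof -
  obtain k where k: "k < m" "u = dfs_vertex t (Suc k)"
    using dfs_vertex_cases[OF t] u by blast
  have "\<not> k < i"
    using u k dfs_vertex_explored_iff[OF t, of i k] i by simp
  moreover have "k \<noteq> i"
    using u k dfs_stack_Cons[OF t i] by (metis DiffD2 UnCI list.set_intros(1))
  ultimately have "i < k" by simp
  then show ?thesis using that k by blast
qed

text \<open>
  A parent is processed before its children, whereas a vertex that is still unexplored will be
  processed later.
\<close>

lemma unexplored_not_parent:
  assumes t: "t \<in> ordered_trees m" and i: "i < m"
    and u: "u \<in> {1..m} - (set (dfs_stack t i) \<union> explored t i)"
  shows "dfs_vertex t (Suc i) \<notin> set (children t u)"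
proof
  assume v: "dfs_vertex t (Suc i) \<in> set (children t u)"
  obtain k where k: "i < k" "k < m" "u = dfs_vertex t (Suc k)"
    using unexplored_later[OF t i u] .
  have "dfs_vertex t (Suc i) \<notin> explored t k"
    using child_later[OF t k(2)] v k(3) by blast
  then show False
    using dfs_vertex_explored_iff[OF t, of k i] i k by simp
qed

lemma child_not_parent:
  assumes t: "t \<in> ordered_trees m" and u: "u \<in> set (children t v)"
  shows "v \<notin> set (children t u)"
proof -
  obtain i where i: "i < m" "v = dfs_vertex t (Suc i)"
    using dfs_vertex_cases[OF t] ordered_treesD(4)[OF t u] by blast
  then show ?thesis
    using unexplored_not_parent[OF t i(1)] child_later[OF t i(1)] u by blast
qed

lemma permitted_edges_alt:
  "permitted_edges m t =
     {{dfs_vertex t (Suc i), j} | i j. i < m \<and> j \<in> set (dfs_stack t i) - {dfs_vertex t (Suc i)}}"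
proof -
  have "(\<exists>i j. e = {dfs_vertex t i, j} \<and> i \<in> {1..m} \<and>
            j \<in> set (dfs_stack t (i - 1)) - {dfs_vertex t i}) \<longleftrightarrow>
        (\<exists>i j. e = {dfs_vertex t (Suc i), j} \<and> i < m \<and>
            j \<in> set (dfs_stack t i) - {dfs_vertex t (Suc i)})" (is "?L \<longleftrightarrow> ?R") for e
  proof
    assume ?L
    then obtain i j where "e = {dfs_vertex t i, j}" "i \<in> {1..m}"
      "j \<in> set (dfs_stack t (i - 1)) - {dfs_vertex t i}" by blast
    then show ?R by (intro exI[of _ "i - 1"] exI[of _ j]) auto
  next
    assume ?R
    then obtain i j where "e = {dfs_vertex t (Suc i), j}" "i < m"
      "j \<in> set (dfs_stack t i) - {dfs_vertex t (Suc i)}" by blast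
    then show ?L by (intro exI[of _ "Suc i"] exI[of _ j]) auto
  qed
  then show ?thesis unfolding permitted_edges_def by blast
qed

text \<open>
  A pair is permitted on account of its earlier endpoint only: when the later one is processed, the
  earlier one has left the stack. So a vertex unexplored at the earlier step excludes the pair.
\<close>

lemma not_permitted:
  assumes t: "t \<in> ordered_trees m" and i: "i < m"
    and u: "u \<in> {1..m} - (set (dfs_stack t i) \<union> explored t i)"
  shows "{dfs_vertex t (Suc i), u} \<notin> permitted_edges m t"
proof
  assume "{dfs_vertex t (Suc i), u} \<in> permitted_edges m t"
  then obtain k w where k: "k < m" "w \<in> set (dfs_stack t k)"
    and eq: "{dfs_vertex t (Suc i), u} = {dfs_vertex t (Suc k), w}"
    unfolding permitted_edges_alt by blast
  have inj: "inj_on (\<lambda>i. dfs_vertex t (Suc i)) {..<m}"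
    using dfs_vertex_bij_betw[OF t] by (rule bij_betw_imp_inj_on)
  from eq consider "dfs_vertex t (Suc i) = dfs_vertex t (Suc k)" "u = w"
    | "u = dfs_vertex t (Suc k)" "w = dfs_vertex t (Suc i)"
    by (auto simp: doubleton_eq_iff)
  then show False
  proof cases
    case 1
    then have "i = k" using inj_onD[OF inj] i k(1) by blast
    then show ?thesis using u k 1 by simp
  next
    case 2
    obtain k' where "i < k'" "k' < m" "u = dfs_vertex t (Suc k')"
      using unexplored_later[OF t i u] .
    then have "i < k" using inj_onD[OF inj, of k k'] 2 k(1) by simp
    then have "w \<in> explored t k"
      using dfs_vertex_explored_iff[OF t, of k i] 2 i k by simp
    then show ?thesis
      using k dfs_invariant_holds[OF t, of k] unfolding dfs_invariant_def by auto
  qed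
qed

lemma tree_edge_cases:
  assumes t: "t \<in> ordered_trees m" and "e \<in> tree_edges t"
  obtains i u where "i < m" "u \<in> set (children t (dfs_vertex t (Suc i)))"
    "e = {dfs_vertex t (Suc i), u}"
proof -
  obtain v u where e: "e = {v, u}" "u \<in> set (children t v)"
    using assms(2) unfolding tree_edges_def by blast
  obtain i where "i < m" "v = dfs_vertex t (Suc i)"
    using dfs_vertex_cases[OF t] ordered_treesD(4)[OF t e(2)] by blast
  then show ?thesis using that e by blast
qed

lemma tree_permitted_disjoint:
  assumes t: "t \<in> ordered_trees m"
  shows "tree_edges t \<inter> permitted_edges m t = {}"
proof -
  have "e \<notin> permitted_edges m t" if "e \<in> tree_edges t" for e
    using tree_edge_cases[OF t that] not_permitted[OF t] child_later[OF t] by metis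
  then show ?thesis by blast
qed

lemma tree_edges_subset:
  assumes t: "t \<in> ordered_trees m"
  shows "tree_edges t \<subseteq> all_edges m"
proof
  fix e assume "e \<in> tree_edges t"
  then obtain v u where e: "e = {v, u}" "u \<in> set (children t v)"
    unfolding tree_edges_def by blast
  moreover have "v \<noteq> u" using child_not_parent[OF t e(2)] e(2) by blast
  ultimately show "e \<in> all_edges m"
    using ordered_treesD(4)[OF t e(2)] unfolding all_edges_def by blast
qed

lemma permitted_edges_subset:
  assumes t: "t \<in> ordered_trees m"
  shows "permitted_edges m t \<subseteq> all_edges m"
proof
  fix e assume "e \<in> permitted_edges m t"
  then obtain i j where e: "e = {dfs_vertex t (Suc i), j}" "i < m"
      "j \<in> set (dfs_stack t i) - {dfs_vertex t (Suc i)}"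
    unfolding permitted_edges_alt by blast
  obtain A where "dfs_stack t i = dfs_vertex t (Suc i) # A"
    using dfs_stack_Cons[OF t e(2)] .
  then have "dfs_vertex t (Suc i) \<in> set (dfs_stack t i)" by simp
  then have "dfs_vertex t (Suc i) \<in> {1..m}" "j \<in> {1..m}"
    using dfs_invariant_vertices[OF t dfs_invariant_holds[OF t, of i]] e(2,3) by auto
  then show "e \<in> all_edges m"
    using e unfolding all_edges_def by blast
qed

section \<open>Graphs compatible with a tree\<close>

text \<open>What step \<open>i + 1\<close> of a search of \<open>G\<close> discovers if its first \<open>i\<close> steps agree with the search of \<open>t\<close>.\<close>

definition discovered :: "nat \<Rightarrow> nat set set \<Rightarrow> otree \<Rightarrow> nat \<Rightarrow> nat set" where
  "discovered m G t i =
     {u \<in> {1..m} - (set (dfs_stack t i) \<union> explored t i). {dfs_vertex t (Suc i), u} \<in> G}"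

text \<open>
  This turns the global condition on \<open>G\<close> into one condition for each step of the search, which is the
  form in which the randomized search tests it.
\<close>

lemma compatible_iff_discovered:
  assumes t: "t \<in> ordered_trees m" and G: "G \<subseteq> all_edges m"
  shows "(tree_edges t \<subseteq> G \<and> G \<subseteq> tree_edges t \<union> permitted_edges m t) \<longleftrightarrow>
         (\<forall>i<m. set (children t (dfs_vertex t (Suc i))) = discovered m G t i)"
    (is "?L \<longleftrightarrow> ?R")
proof
  assume L: ?L
  show ?R
  proof (intro allI impI)
    fix i assume i: "i < m"
    define v where "v = dfs_vertex t (Suc i)"
    show "set (children t (dfs_vertex t (Suc i))) = discovered m G t i"
    proof
      show "set (children t (dfs_vertex t (Suc i))) \<subseteq> discovered m G t i"
        using child_later[OF t i] L unfolding discovered_def tree_edges_def by blast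
      show "discovered m G t i \<subseteq> set (children t (dfs_vertex t (Suc i)))"
      proof
        fix u assume "u \<in> discovered m G t i"
        then have u: "u \<in> {1..m} - (set (dfs_stack t i) \<union> explored t i)" and "{v, u} \<in> G"
          unfolding discovered_def v_def by blast+
        then have "{v, u} \<in> tree_edges t"
          using not_permitted[OF t i u] L v_def by blast
        then have "u \<in> set (children t v) \<or> v \<in> set (children t u)"
          unfolding tree_edges_def by (auto simp: doubleton_eq_iff)
        moreover have "v \<notin> set (children t u)"
          unfolding v_def by (rule unexplored_not_parent[OF t i u])
        ultimately show "u \<in> set (children t (dfs_vertex t (Suc i)))"
          unfolding v_def by blast
      qed
    qed
  qed
next
  assume R: ?R
  have "e \<in> G" if e: "e \<in> tree_edges t" for e
  proof -
    obtain i u where i: "i < m" "u \<in> set (children t (dfs_vertex t (Suc i)))"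
        "e = {dfs_vertex t (Suc i), u}"
      using tree_edge_cases[OF t e] .
    then show ?thesis using R unfolding discovered_def by blast
  qed
  moreover have "e \<in> tree_edges t \<union> permitted_edges m t" if e: "e \<in> G" for e
  proof -
    obtain x y where xy: "e = {x, y}" "x \<in> {1..m}" "y \<in> {1..m}" "x \<noteq> y"
      using e G unfolding all_edges_def by blast
    obtain i' k' where ik': "i' < m" "x = dfs_vertex t (Suc i')" "k' < m" "y = dfs_vertex t (Suc k')"
      using dfs_vertex_cases[OF t] xy(2,3) by metis
    \<comment> \<open>Orient the pair so that the endpoint processed first comes first.\<close>
    then have "i' < k' \<or> k' < i'" using xy(4) by (metis nat_neq_iff)
    moreover have "e = {dfs_vertex t (Suc i'), dfs_vertex t (Suc k')}"
      "e = {dfs_vertex t (Suc k'), dfs_vertex t (Suc i')}"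
      using xy ik' by auto
    ultimately obtain i k where ik: "i < k" "k < m" "e = {dfs_vertex t (Suc i), dfs_vertex t (Suc k)}"
      using ik' by metis
    define u where "u = dfs_vertex t (Suc k)"
    have u: "u \<in> {1..m}" "u \<noteq> dfs_vertex t (Suc i)"
      using ik xy ik' u_def by (auto simp: doubleton_eq_iff)
    have "u \<notin> explored t i"
      using dfs_vertex_explored_iff[OF t, of i k] ik u_def by simp
    then consider "u \<in> set (dfs_stack t i)" | "u \<in> {1..m} - (set (dfs_stack t i) \<union> explored t i)"
      using u by blast
    then show ?thesis
    proof cases
      case 1
      then have "e \<in> permitted_edges m t"
        using ik u unfolding permitted_edges_alt u_def by force
      then show ?thesis by blast
    next
      case 2
      then have "u \<in> discovered m G t i"
        using e ik unfolding discovered_def u_def by blast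
      then have "u \<in> set (children t (dfs_vertex t (Suc i)))"
        using R ik by simp
      then show ?thesis using ik unfolding tree_edges_def u_def by blast
    qed
  qed
  ultimately show ?L by blast
qed

section \<open>The law of the randomized search\<close>

text \<open>
  Steps are prepended here, not appended as in \<open>rdfs_run\<close>. Analysing the first of the remaining steps is
  what makes the recursion for the success probability easy: the ordering drawn there is recorded
  for good, so at most one of the outcomes can still lead to a given tree.
\<close>

primrec rdfs_from :: "nat \<Rightarrow> nat set set \<Rightarrow> nat \<Rightarrow> rdfs_state \<Rightarrow> rdfs_state pmf" where
  "rdfs_from m G 0 s = return_pmf s"
| "rdfs_from m G (Suc n) s = bind_pmf (rdfs_step m G s) (rdfs_from m G n)"

lemma rdfs_run_add: "rdfs_run m G r (i + n) = bind_pmf (rdfs_run m G r i) (rdfs_from m G n)"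
proof (induction n arbitrary: i)
  case 0
  show ?case by (simp add: bind_return_pmf')
next
  case (Suc n)
  have "rdfs_run m G r (i + Suc n) = rdfs_run m G r (Suc i + n)" by simp
  also have "\<dots> = bind_pmf (rdfs_run m G r (Suc i)) (rdfs_from m G n)" by (rule Suc.IH)
  also have "\<dots> = bind_pmf (rdfs_run m G r i) (rdfs_from m G (Suc n))"
    unfolding rdfs_run.simps bind_assoc_pmf by (intro bind_pmf_cong refl) simp
  finally show ?case .
qed

lemma rdfs_step_Cons:
  assumes "D = {u \<in> {1..m} - (set (v # A) \<union> X). {v, u} \<in> G}"
  shows "rdfs_step m G (v # A, X, ch) =
    map_pmf (\<lambda>us. (us @ A, insert v X, ch(v := us))) (pmf_of_set (permutations_of_set D))"
  unfolding assms rdfs_step.simps Let_def ..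

lemma set_pmf_rdfs_step_Cons:
  assumes "D = {u \<in> {1..m} - (set (v # A) \<union> X). {v, u} \<in> G}"
  shows "set_pmf (rdfs_step m G (v # A, X, ch)) =
    (\<lambda>us. (us @ A, insert v X, ch(v := us))) ` permutations_of_set D"
proof -
  have "finite D" unfolding assms by simp
  then show ?thesis unfolding rdfs_step_Cons[OF assms] by simp
qed

text \<open>An explored vertex never returns to the stack, so its list of children is not overwritten.\<close>

lemma rdfs_from_children_explored:
  assumes "(A', X', ch') \<in> set_pmf (rdfs_from m G n (A, X, ch))"
    and "distinct A" "set A \<inter> X = {}" "v \<in> X"
  shows "ch' v = ch v"
  using assms
proof (induction n arbitrary: A X ch)
  case 0
  then show ?case by simp
next
  case (Suc n)
  show ?case
  proof (cases A)
    case Nil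
    then show ?thesis using Suc.IH[of "[]" X ch] Suc.prems by (simp add: bind_return_pmf)
  next
    case (Cons w B)
    define D where "D = {u \<in> {1..m} - (set (w # B) \<union> X). {w, u} \<in> G}"
    obtain us where us: "us \<in> permutations_of_set D"
      and mem: "(A', X', ch') \<in> set_pmf (rdfs_from m G n (us @ B, insert w X, ch(w := us)))"
      using Suc.prems(1) unfolding Cons rdfs_from.simps set_bind_pmf set_pmf_rdfs_step_Cons[OF D_def]
      by blast
    have D: "set us = D" "distinct us"
      using us by (auto simp: permutations_of_set_def)
    have "ch' v = (ch(w := us)) v"
      using D Suc.prems(2-4) Cons by (intro Suc.IH[OF mem]) (auto simp: D_def)
    then show ?thesis using Suc.prems(3,4) Cons by auto
  qed
qed

text \<open>
  The starting state is the one that the search has reached after \<open>i\<close> steps if it has reproduced \<open>t\<close>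
  so far. From there the probability of completing \<open>t\<close> is a product over the remaining steps.
\<close>

lemma pmf_rdfs_from:
  assumes t: "t \<in> ordered_trees m" and "i + n = m"
  shows "pmf (map_pmf (\<lambda>s. snd (snd s)) (rdfs_from m G n
           (dfs_stack t i, explored t i, \<lambda>v. if v \<in> explored t i then children t v else [])))
           (children t) =
         (\<Prod>j\<in>{i..<m}. if set (children t (dfs_vertex t (Suc j))) = discovered m G t j
            then 1 / fact (length (children t (dfs_vertex t (Suc j)))) else 0)"
  using \<open>i + n = m\<close>
proof (induction n arbitrary: i)
  case 0
  then have "(\<lambda>v. if v \<in> explored t i then children t v else []) = children t"
    using explored_all[OF t] ordered_treesD(2)[OF t] by auto
  then show ?case using 0 by simp
next
  case (Suc n)
  then have i: "i < m" by simp
  define v where "v = dfs_vertex t (Suc i)"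
  obtain A where A: "dfs_stack t i = v # A"
    using dfs_stack_Cons[OF t i] unfolding v_def .
  define X where "X = explored t i"
  define ch where "ch = (\<lambda>v. if v \<in> X then children t v else [])"
  define D where "D = discovered m G t i"
  have D: "D = {u \<in> {1..m} - (set (v # A) \<union> X). {v, u} \<in> G}"
    unfolding D_def discovered_def A X_def v_def ..
  have "finite D" unfolding D by simp
  have inv: "distinct (v # A)" "set (v # A) \<inter> X = {}"
    using dfs_invariant_holds[OF t, of i] i unfolding dfs_invariant_def A X_def by auto
  define f where "f us = map_pmf (\<lambda>s. snd (snd s))
      (rdfs_from m G n (us @ A, insert v X, ch(v := us)))" for us
  have "map_pmf (\<lambda>s. snd (snd s)) (rdfs_from m G (Suc n) (v # A, X, ch)) =
      bind_pmf (pmf_of_set (permutations_of_set D)) f"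
    unfolding f_def by (simp only: rdfs_from.simps rdfs_step_Cons[OF D] map_bind_pmf bind_map_pmf)
  then have "pmf (map_pmf (\<lambda>s. snd (snd s)) (rdfs_from m G (Suc n) (v # A, X, ch))) (children t) =
      (\<Sum>us\<in>permutations_of_set D. pmf (f us) (children t)) / fact (card D)"
    using \<open>finite D\<close> by (simp add: pmf_bind_pmf_of_set)
  \<comment> \<open>Any other ordering than the list of children in \<open>t\<close> is recorded at \<open>v\<close> and rules \<open>t\<close> out.\<close>
  also have "(\<Sum>us\<in>permutations_of_set D. pmf (f us) (children t)) =
      (\<Sum>us\<in>permutations_of_set D. if us = children t v then pmf (f (children t v)) (children t) else 0)"
  proof (intro sum.cong refl)
    fix us assume us: "us \<in> permutations_of_set D"
    have "us = children t v" if reach: "children t \<in> set_pmf (f us)"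
    proof -
      obtain A' X' where mem:
        "(A', X', children t) \<in> set_pmf (rdfs_from m G n (us @ A, insert v X, ch(v := us)))"
        using reach unfolding f_def by auto
      have "children t v = (ch(v := us)) v"
        using us inv by (intro rdfs_from_children_explored[OF mem])
          (auto simp: D permutations_of_set_def)
      then show ?thesis by simp
    qed
    then show "pmf (f us) (children t) =
        (if us = children t v then pmf (f (children t v)) (children t) else 0)"
      by (auto simp: set_pmf_iff)
  qed
  also have "\<dots> = (if set (children t v) = D then pmf (f (children t v)) (children t) else 0)"
    using ordered_treesD(3)[OF t, of v]
    by (subst sum.delta) (auto simp: permutations_of_setI dest: permutations_of_setD)
  also have "f (children t v) = map_pmf (\<lambda>s. snd (snd s)) (rdfs_from m G n
           (dfs_stack t (Suc i), explored t (Suc i),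
            \<lambda>v. if v \<in> explored t (Suc i) then children t v else []))"
  proof -
    have "ch(v := children t v) = (\<lambda>w. if w \<in> explored t (Suc i) then children t w else [])"
      unfolding ch_def explored_Suc v_def[symmetric] X_def[symmetric] by auto
    then show ?thesis
      unfolding f_def by (simp add: A explored_Suc v_def[symmetric] X_def[symmetric])
  qed
  also have "pmf \<dots> (children t) =
      (\<Prod>j\<in>{Suc i..<m}. if set (children t (dfs_vertex t (Suc j))) = discovered m G t j
            then 1 / fact (length (children t (dfs_vertex t (Suc j)))) else 0)"
    using Suc.prems by (intro Suc.IH) simp
  also have "(if set (children t v) = D then \<dots> else 0) / fact (card D) =
      (\<Prod>j\<in>{i..<m}. if set (children t (dfs_vertex t (Suc j))) = discovered m G t j
            then 1 / fact (length (children t (dfs_vertex t (Suc j)))) else 0)"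
    using i distinct_card[OF ordered_treesD(3)[OF t, of v]]
    by (auto simp: prod.atLeast_Suc_lessThan v_def[symmetric] D_def[symmetric])
  finally show ?case
    unfolding A X_def ch_def .
qed

text \<open>The tree records its root, so only runs started at that root can produce it.\<close>

lemma pmf_rdfs_tree:
  "pmf (rdfs_tree m p G) t = pmf p (root t) *
     pmf (map_pmf (\<lambda>s. snd (snd s)) (rdfs_run m G (root t) m)) (children t)"
proof -
  define g where "g r = map_pmf (\<lambda>s. snd (snd s)) (rdfs_run m G r m)" for r
  have "map_pmf (\<lambda>(A, X, ch). OTree r ch) (rdfs_run m G r m) = map_pmf (OTree r) (g r)" for r
    unfolding g_def map_pmf_comp by (intro map_pmf_cong) auto
  then have "rdfs_tree m p G = bind_pmf p (\<lambda>r. map_pmf (OTree r) (g r))"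
    unfolding rdfs_tree_def by simp
  then have "pmf (rdfs_tree m p G) t =
      measure_pmf.expectation p (\<lambda>r. pmf (map_pmf (OTree r) (g r)) t)"
    by (simp add: pmf_bind)
  also have "(\<lambda>r. pmf (map_pmf (OTree r) (g r)) t) =
      (\<lambda>r. pmf (g (root t)) (children t) * indicat_real {root t} r)"
  proof
    fix r
    show "pmf (map_pmf (OTree r) (g r)) t = pmf (g (root t)) (children t) * indicat_real {root t} r"
    proof (cases "r = root t")
      case True
      have "inj (OTree r)" by (auto simp: inj_on_def)
      then have "pmf (map_pmf (OTree r) (g r)) (OTree r (children t)) = pmf (g r) (children t)"
        by (rule pmf_map_inj')
      then show ?thesis using True by simp
    next
      case False
      then have "t \<notin> set_pmf (map_pmf (OTree r) (g r))" by auto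
      then have "pmf (map_pmf (OTree r) (g r)) t = 0" by (simp only: set_pmf_iff not_not)
      then show ?thesis using False by simp
    qed
  qed
  also have "measure_pmf.expectation p \<dots> = pmf (g (root t)) (children t) * pmf p (root t)"
    by (simp add: measure_pmf_single)
  finally show ?thesis unfolding g_def by simp
qed

lemma nu_dfs_eq:
  assumes t: "t \<in> ordered_trees m" and G: "G \<in> connected_graphs m"
  shows "nu_dfs m p G t = (if G \<in> compatible_graphs m t
     then pmf p (root t) * (\<Prod>v\<in>{1..m}. 1 / fact (length (children t v))) else 0)"
proof -
  have "rdfs_run m G (root t) m = rdfs_from m G m ([root t], {}, \<lambda>_. [])"
    using rdfs_run_add[of m G "root t" 0 m] by (simp add: bind_return_pmf)
  then have nu: "nu_dfs m p G t = pmf p (root t) *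
      (\<Prod>j\<in>{0..<m}. if set (children t (dfs_vertex t (Suc j))) = discovered m G t j
            then 1 / fact (length (children t (dfs_vertex t (Suc j)))) else 0)"
    using pmf_rdfs_from[OF t, of 0 m G] by (simp add: nu_dfs_def pmf_rdfs_tree)
  have compat: "G \<in> compatible_graphs m t \<longleftrightarrow>
      (\<forall>j<m. set (children t (dfs_vertex t (Suc j))) = discovered m G t j)"
    using compatible_iff_discovered[OF t, of G] G
    unfolding compatible_graphs_def connected_graphs_def by blast
  show ?thesis
  proof (cases "G \<in> compatible_graphs m t")
    case True
    then have "nu_dfs m p G t = pmf p (root t) *
        (\<Prod>j\<in>{..<m}. 1 / fact (length (children t (dfs_vertex t (Suc j)))))"
      unfolding nu using compat by (simp add: atLeast0LessThan)
    also have "(\<Prod>j\<in>{..<m}. 1 / fact (length (children t (dfs_vertex t (Suc j)))) :: real) =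
        (\<Prod>v\<in>{1..m}. 1 / fact (length (children t v)))"
      by (rule prod.reindex_bij_betw[OF dfs_vertex_bij_betw[OF t]])
    finally show ?thesis using True by simp
  next
    case False
    then obtain j where "j < m" "set (children t (dfs_vertex t (Suc j))) \<noteq> discovered m G t j"
      using compat by blast
    then show ?thesis unfolding nu using False by auto
  qed
qed

section \<open>The randomized search ends in an ordered tree\<close>

text \<open>
  The counterpart of \<open>dfs_invariant\<close> when no target tree is given: the recorded lists form an ordered
  tree on the vertices found so far, and the explored vertices have no undiscovered neighbours. The
  last condition is what forces a search with an empty stack to have exhausted a connected graph.
\<close>

locale rdfs_invariant =
  fixes m :: nat and G :: "nat set set" and r i :: nat
    and A :: "nat list" and X :: "nat set" and ch :: "nat \<Rightarrow> nat list"
  assumes distinct_stack: "distinct A"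
    and stack_explored: "set A \<inter> X = {}"
    and card_explored: "card X = i"
    and found: "set A \<union> X = insert r (\<Union>v. set (ch v))"
    and vertices: "set A \<union> X \<subseteq> {1..m}"
    and no_children: "v \<notin> X \<Longrightarrow> ch v = []"
    and distinct_children: "distinct (ch v)"
    and root_no_child: "r \<notin> set (ch v)"
    and unique_parent: "u \<in> set (ch v) \<Longrightarrow> u \<in> set (ch w) \<Longrightarrow> v = w"
    and reachable: "u \<in> set A \<union> X \<Longrightarrow> (r, u) \<in> {(x, y). y \<in> set (ch x)}\<^sup>*"
    and neighbours_found: "x \<in> X \<Longrightarrow> u \<in> {1..m} \<Longrightarrow> {x, u} \<in> G \<Longrightarrow> u \<in> set A \<union> X"

lemma rdfs_invariant_Nil:
  assumes inv: "rdfs_invariant m G r i [] X ch" and G: "G \<in> connected_graphs m"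
  shows "i = m"
proof -
  interpret rdfs_invariant m G r i "[]" X ch by (rule inv)
  have r: "r \<in> X" using found by simp
  have X: "X \<subseteq> {1..m}" using vertices by simp
  have vertex: "y \<in> {1..m}" if "{x, y} \<in> G" for x y
  proof -
    have "{x, y} \<in> all_edges m" using that G unfolding connected_graphs_def by blast
    then show ?thesis unfolding all_edges_def by (auto simp: doubleton_eq_iff)
  qed
  have "u \<in> X" if "(r, u) \<in> {(x, y). {x, y} \<in> G}\<^sup>*" for u
    using that
  proof (induction rule: rtrancl_induct)
    case base
    show ?case by (rule r)
  next
    case (step y z)
    then have "{y, z} \<in> G" by simp
    then show ?case using neighbours_found[OF step.IH vertex] by simp
  qed
  moreover have "\<forall>u\<in>{1..m}. (r, u) \<in> {(x, y). {x, y} \<in> G}\<^sup>*"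
    using G r X unfolding connected_graphs_def by blast
  ultimately have "X = {1..m}" using X by blast
  then show ?thesis using card_explored by simp
qed

lemma rdfs_invariant_step:
  assumes inv: "rdfs_invariant m G r i (v # A) X ch"
    and D: "D = {u \<in> {1..m} - (set (v # A) \<union> X). {v, u} \<in> G}"
    and us: "us \<in> permutations_of_set D"
  shows "rdfs_invariant m G r (Suc i) (us @ A) (insert v X) (ch(v := us))"
proof -
  interpret rdfs_invariant m G r i "v # A" X ch by (rule inv)
  have set_us: "set us = D" and "distinct us"
    using us by (simp_all add: permutations_of_set_def)
  let ?ch = "ch(v := us)"
  define F where "F = set (v # A) \<union> X"
  have "finite X"
    using vertices by (meson finite_Un finite_atLeastAtMost finite_subset)
  have "v \<notin> X" using stack_explored by simp
  then have ch_v: "ch v = []" by (rule no_children)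
  have D_new: "D \<inter> F = {}" unfolding D F_def by blast
  have F': "set (us @ A) \<union> insert v X = F \<union> D"
    using set_us unfolding F_def by auto
  have sub: "set (ch w) \<subseteq> F" for w
    unfolding F_def found by blast
  have ch': "set (?ch w) = (if w = v then D else set (ch w))" for w
    using set_us by simp
  have mono: "{(x, y). y \<in> set (ch x)} \<subseteq> {(x, y). y \<in> set (?ch x)}"
    using ch_v by auto
  have reach_old: "(r, u) \<in> {(x, y). y \<in> set (?ch x)}\<^sup>*" if "u \<in> F" for u
    using reachable that rtrancl_mono[OF mono] unfolding F_def by blast
  have reach_new: "(r, u) \<in> {(x, y). y \<in> set (?ch x)}\<^sup>*" if "u \<in> D" for u
  proof (rule rtrancl_into_rtrancl)
    show "(r, v) \<in> {(x, y). y \<in> set (?ch x)}\<^sup>*" by (rule reach_old) (simp add: F_def)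
    show "(v, u) \<in> {(x, y). y \<in> set (?ch x)}" using that set_us by simp
  qed
  show ?thesis
  proof
    show "distinct (us @ A)"
      using \<open>distinct us\<close> distinct_stack D_new set_us unfolding F_def by auto
    show "set (us @ A) \<inter> insert v X = {}"
      using distinct_stack stack_explored D_new set_us unfolding F_def by auto
    show "card (insert v X) = Suc i"
      using card_explored \<open>finite X\<close> \<open>v \<notin> X\<close> by simp
    have "(\<Union>w. set (?ch w)) = (\<Union>w. set (ch w)) \<union> D"
    proof
      show "(\<Union>w. set (?ch w)) \<subseteq> (\<Union>w. set (ch w)) \<union> D"
        unfolding ch' by auto
      have "set (ch w) \<subseteq> set (?ch w)" for w using ch_v by simp
      moreover have "D \<subseteq> set (?ch v)" using set_us by simp
      ultimately show "(\<Union>w. set (ch w)) \<union> D \<subseteq> (\<Union>w. set (?ch w))" by blast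
    qed
    then show "set (us @ A) \<union> insert v X = insert r (\<Union>w. set (?ch w))"
      unfolding F' using found F_def by simp
    show "set (us @ A) \<union> insert v X \<subseteq> {1..m}"
      unfolding F' using vertices D unfolding F_def by blast
    show "?ch w = []" if "w \<notin> insert v X" for w
      using that no_children by simp
    show "distinct (?ch w)" for w
      using distinct_children \<open>distinct us\<close> by simp
    show "r \<notin> set (?ch w)" for w
    proof -
      have "r \<in> F" unfolding F_def found by simp
      then show ?thesis using root_no_child D_new unfolding ch' by auto
    qed
    show "w = w'" if "u \<in> set (?ch w)" "u \<in> set (?ch w')" for u w w'
      using that sub[of w] sub[of w'] D_new unique_parent[of u w w'] unfolding ch'
      by (auto split: if_splits)
    show "(r, u) \<in> {(x, y). y \<in> set (?ch x)}\<^sup>*" if "u \<in> set (us @ A) \<union> insert v X" for u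
      using that reach_old reach_new unfolding F' by blast
    show "u \<in> set (us @ A) \<union> insert v X" if "x \<in> insert v X" "u \<in> {1..m}" "{x, u} \<in> G" for x u
    proof (cases "x = v")
      case True
      then show ?thesis using that unfolding F' F_def D by blast
    next
      case False
      then have "u \<in> F" using that neighbours_found[of x u] unfolding F_def by simp
      then show ?thesis unfolding F' by blast
    qed
  qed
qed

lemma rdfs_run_invariant:
  assumes G: "G \<in> connected_graphs m" and r: "r \<in> {1..m}"
    and "i \<le> m" and "(A, X, ch) \<in> set_pmf (rdfs_run m G r i)"
  shows "rdfs_invariant m G r i A X ch"
  using assms(3,4)
proof (induction i arbitrary: A X ch)
  case 0
  then have "A = [r]" "X = {}" "ch = (\<lambda>_. [])" by auto
  then show ?case using r by unfold_locales auto
next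
  case (Suc i)
  obtain s where "s \<in> set_pmf (rdfs_run m G r i)" "(A, X, ch) \<in> set_pmf (rdfs_step m G s)"
    using Suc.prems(2) by auto
  then obtain A' X' ch' where
    s: "(A', X', ch') \<in> set_pmf (rdfs_run m G r i)" "(A, X, ch) \<in> set_pmf (rdfs_step m G (A', X', ch'))"
    by (cases s) blast
  have inv: "rdfs_invariant m G r i A' X' ch'"
    using Suc.IH[OF _ s(1)] Suc.prems(1) by simp
  have "A' \<noteq> []"
  proof
    assume "A' = []"
    then have "i = m" using rdfs_invariant_Nil[OF _ G] inv by blast
    then show False using Suc.prems(1) by simp
  qed
  then obtain v B where A': "A' = v # B" by (cases A') auto
  define D where "D = {u \<in> {1..m} - (set (v # B) \<union> X'). {v, u} \<in> G}"
  obtain us where us: "us \<in> permutations_of_set D"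
    and "A = us @ B" "X = insert v X'" "ch = ch'(v := us)"
    using s(2) unfolding A' set_pmf_rdfs_step_Cons[OF D_def] by blast
  then show ?case
    using rdfs_invariant_step[OF inv[unfolded A'] D_def us] by (simp only:)
qed

lemma rdfs_invariant_final:
  assumes inv: "rdfs_invariant m G r m A X ch"
  shows "OTree r ch \<in> ordered_trees m"
proof -
  interpret rdfs_invariant m G r m A X ch by (rule inv)
  have X: "X = {1..m}"
    using vertices card_explored by (intro card_subset_eq) auto
  then have all: "insert r (\<Union>v. set (ch v)) = {1..m}"
    using vertices found by blast
  have "r \<in> {1..m}" and sub: "\<And>v. set (ch v) \<subseteq> {1..m}"
    unfolding all[symmetric] by blast+
  moreover have "\<forall>v. v \<notin> {1..m} \<longrightarrow> ch v = []"
    using no_children unfolding X by blast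
  moreover have "\<forall>v\<in>{1..m}. distinct (ch v) \<and> set (ch v) \<subseteq> {1..m} - {r}"
    using distinct_children root_no_child sub by blast
  moreover have "\<forall>u\<in>{1..m} - {r}. \<exists>!v. u \<in> set (ch v)"
  proof
    fix u assume "u \<in> {1..m} - {r}"
    then have "u \<in> (\<Union>v. set (ch v))" unfolding all[symmetric] by blast
    then show "\<exists>!v. u \<in> set (ch v)" using unique_parent by blast
  qed
  moreover have "\<forall>u\<in>{1..m}. (r, u) \<in> {(x, y). y \<in> set (ch x)}\<^sup>*"
    using reachable unfolding X by blast
  ultimately show ?thesis
    unfolding ordered_trees_def by simp
qed

lemma finite_ordered_trees: "finite (ordered_trees m)"
proof -
  define F where "F = {f :: nat \<Rightarrow> nat list. \<forall>v. (v \<in> {1..m} \<longrightarrow>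
      f v \<in> {xs. set xs \<subseteq> {1..m} \<and> distinct xs}) \<and> (v \<notin> {1..m} \<longrightarrow> f v = [])}"
  have "finite F"
    unfolding F_def by (intro finite_set_of_finite_funs finite_subset_distinct) auto
  moreover have "ordered_trees m \<subseteq> (\<lambda>(r, f). OTree r f) ` ({1..m} \<times> F)"
  proof
    fix t assume t: "t \<in> ordered_trees m"
    have "children t \<in> F"
      unfolding F_def using ordered_treesD(2,3,4)[OF t] by blast
    then have "(root t, children t) \<in> {1..m} \<times> F"
      using ordered_treesD(1)[OF t] by blast
    moreover have "t = (\<lambda>(r, f). OTree r f) (root t, children t)" by simp
    ultimately show "t \<in> (\<lambda>(r, f). OTree r f) ` ({1..m} \<times> F)" by blast
  qed
  ultimately show ?thesis
    by (meson finite_SigmaI finite_atLeastAtMost finite_imageI finite_subset)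
qed

lemma sum_nu_dfs:
  assumes G: "G \<in> connected_graphs m" and p: "set_pmf p = {1..m}"
  shows "(\<Sum>t\<in>ordered_trees m. nu_dfs m p G t) = 1"
  unfolding nu_dfs_def
proof (rule sum_pmf_eq_1[OF finite_ordered_trees])
  show "set_pmf (rdfs_tree m p G) \<subseteq> ordered_trees m"
  proof
    fix t assume "t \<in> set_pmf (rdfs_tree m p G)"
    then obtain r A X ch where r: "r \<in> {1..m}" and s: "(A, X, ch) \<in> set_pmf (rdfs_run m G r m)"
      and t: "t = OTree r ch"
      unfolding rdfs_tree_def using p by auto
    show "t \<in> ordered_trees m"
      unfolding t by (rule rdfs_invariant_final[OF rdfs_run_invariant[OF G r order_refl s]])
  qed
qed

lemma finite_all_edges: "finite (all_edges m)"
  by (rule finite_subset[of _ "Pow {1..m}"]) (auto simp: all_edges_def)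

lemma finite_connected_graphs: "finite (connected_graphs m)"
  by (rule finite_subset[of _ "Pow (all_edges m)"])
    (auto simp: connected_graphs_def finite_all_edges)

lemma connected_if_contains_tree:
  assumes t: "t \<in> ordered_trees m" and "tree_edges t \<subseteq> G" "G \<subseteq> all_edges m"
  shows "G \<in> connected_graphs m"
proof -
  let ?E = "{(x, y). {x, y} \<in> G}"
  have "{(x, y). y \<in> set (children t x)} \<subseteq> ?E"
    using assms(2) unfolding tree_edges_def by blast
  then have from_root: "(root t, u) \<in> ?E\<^sup>*" if "u \<in> {1..m}" for u
    using ordered_treesD(7)[OF t that] rtrancl_mono by blast
  have "sym (?E\<^sup>*)"
    by (intro sym_rtrancl) (auto simp: sym_def insert_commute)
  then have "(u, v) \<in> ?E\<^sup>*" if "u \<in> {1..m}" "v \<in> {1..m}" for u v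
    using from_root[OF that(1)] from_root[OF that(2)] by (meson rtrancl_trans symD)
  then show ?thesis
    using assms(3) unfolding connected_graphs_def by blast
qed

section \<open>Random permitted edges\<close>

text \<open>
  A compatible graph is the tree together with an arbitrary set of permitted edges, connectedness
  being automatic, so \<open>nu_per\<close> describes independent choices of the permitted edges.
\<close>

lemma sum_nu_per:
  assumes t: "t \<in> ordered_trees m"
  shows "(\<Sum>G\<in>connected_graphs m. nu_per m a p t G) = 1"
proof -
  let ?T = "tree_edges t" and ?Q = "permitted_edges m t"
  have disj: "?T \<inter> ?Q = {}" by (rule tree_permitted_disjoint[OF t])
  have finQ: "finite ?Q"
    using permitted_edges_subset[OF t] finite_all_edges by (rule finite_subset)
  have compat: "compatible_graphs m t = (\<lambda>S. ?T \<union> S) ` Pow ?Q"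
  proof
    show "compatible_graphs m t \<subseteq> (\<lambda>S. ?T \<union> S) ` Pow ?Q"
    proof
      fix G assume "G \<in> compatible_graphs m t"
      then have "G = ?T \<union> (?Q \<inter> G)"
        unfolding compatible_graphs_def by blast
      then show "G \<in> (\<lambda>S. ?T \<union> S) ` Pow ?Q" by blast
    qed
    show "(\<lambda>S. ?T \<union> S) ` Pow ?Q \<subseteq> compatible_graphs m t"
      using connected_if_contains_tree[OF t] tree_edges_subset[OF t] permitted_edges_subset[OF t]
      unfolding compatible_graphs_def by blast
  qed
  have inj: "inj_on (\<lambda>S. ?T \<union> S) (Pow ?Q)"
    using disj by (intro inj_onI) blast
  have "(\<Sum>G\<in>connected_graphs m. nu_per m a p t G) = (\<Sum>G\<in>compatible_graphs m t. nu_per m a p t G)"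
    by (intro sum.mono_neutral_right finite_connected_graphs)
      (auto simp: compatible_graphs_def nu_per_def)
  also have "\<dots> = (\<Sum>S\<in>Pow ?Q. nu_per m a p t (?T \<union> S))"
    unfolding compat by (simp add: sum.reindex[OF inj])
  also have "\<dots> = (\<Sum>S\<in>Pow ?Q. (\<Prod>e\<in>S. edge_prob a p e) * (\<Prod>e\<in>?Q - S. 1 - edge_prob a p e))"
  proof (intro sum.cong refl)
    fix S assume "S \<in> Pow ?Q"
    then have "?Q \<inter> (?T \<union> S) = S" "?Q - (?T \<union> S) = ?Q - S" "?T \<union> S \<in> compatible_graphs m t"
      using disj unfolding compat by blast+
    then show "nu_per m a p t (?T \<union> S) =
        (\<Prod>e\<in>S. edge_prob a p e) * (\<Prod>e\<in>?Q - S. 1 - edge_prob a p e)"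
      unfolding nu_per_def by simp
  qed
  also have "\<dots> = (\<Prod>e\<in>?Q. edge_prob a p e + (1 - edge_prob a p e))"
    by (rule prod_add[OF finQ, symmetric])
  finally show ?thesis by simp
qed

section \<open>Equality of the unnormalised weights\<close>

text \<open>Each edge arises from one parent-child pair only, since no vertex is a child of its child.\<close>

lemma prod_tree_edges:
  assumes t: "t \<in> ordered_trees m"
  shows "(\<Prod>e\<in>tree_edges t. f e) = (\<Prod>v\<in>{1..m}. \<Prod>u\<in>set (children t v). f {v, u})"
proof -
  let ?S = "Sigma {1..m} (\<lambda>v. set (children t v))"
  have "tree_edges t = (\<lambda>(v, u). {v, u}) ` ?S"
  proof -
    have "v \<in> {1..m}" if "u \<in> set (children t v)" for u v
      using ordered_treesD(4)[OF t that] by blast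
    then show ?thesis unfolding tree_edges_def by fast
  qed
  moreover have "inj_on (\<lambda>(v, u). {v, u}) ?S"
    using child_not_parent[OF t] by (auto simp: inj_on_def doubleton_eq_iff)
  ultimately have "(\<Prod>e\<in>tree_edges t. f e) = (\<Prod>(v, u)\<in>?S. f {v, u})"
    by (simp add: prod.reindex case_prod_unfold)
  then show ?thesis
    by (subst prod.Sigma) simp_all
qed

text \<open>
  Each parent contributes its mass once for every child, and each vertex apart from the root
  contributes once as a child. The factor for the root on the left completes the second product; in
  the search it comes from the choice of the starting vertex.
\<close>

lemma prod_tree_edge_mass:
  assumes t: "t \<in> ordered_trees m"
  shows "(\<Prod>e\<in>tree_edges t. a * edge_mass p e) * (a * pmf p (root t)) =
    (\<Prod>v\<in>{1..m}. pmf p v ^ length (children t v)) * (\<Prod>u\<in>{1..m}. a * pmf p u)"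
proof -
  have "(\<Prod>e\<in>tree_edges t. a * edge_mass p e) =
      (\<Prod>v\<in>{1..m}. \<Prod>u\<in>set (children t v). pmf p v * (a * pmf p u))"
    unfolding prod_tree_edges[OF t]
  proof (intro prod.cong refl)
    fix v u assume "u \<in> set (children t v)"
    then have "v \<noteq> u" using child_not_parent[OF t] by blast
    then show "a * edge_mass p {v, u} = pmf p v * (a * pmf p u)"
      by (simp add: edge_mass_def)
  qed
  also have "\<dots> = (\<Prod>v\<in>{1..m}. pmf p v ^ length (children t v)) *
      (\<Prod>v\<in>{1..m}. \<Prod>u\<in>set (children t v). a * pmf p u)"
    using distinct_card[OF ordered_treesD(3)[OF t]] by (simp add: prod.distrib)
  also have "(\<Prod>v\<in>{1..m}. \<Prod>u\<in>set (children t v). a * pmf p u) =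
      (\<Prod>u\<in>(\<Union>v\<in>{1..m}. set (children t v)). a * pmf p u)"
    using ordered_treesD(5)[OF t] by (intro prod.UNION_disjoint[symmetric]) auto
  also have "(\<Union>v\<in>{1..m}. set (children t v)) = {1..m} - {root t}"
  proof
    show "(\<Union>v\<in>{1..m}. set (children t v)) \<subseteq> {1..m} - {root t}"
      using ordered_treesD(4)[OF t] by blast
    show "{1..m} - {root t} \<subseteq> (\<Union>v\<in>{1..m}. set (children t v))"
    proof
      fix u assume "u \<in> {1..m} - {root t}"
      then obtain v where "u \<in> set (children t v)"
        using ordered_treesD(6)[OF t, of u] by blast
      then show "u \<in> (\<Union>v\<in>{1..m}. set (children t v))"
        using ordered_treesD(4)[OF t, of u v] by blast
    qed
  qed
  finally show ?thesis
    using prod.remove[OF _ ordered_treesD(1)[OF t], of "\<lambda>u. a * pmf p u"] by (simp add: ac_simps)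
qed

lemma edge_mass_pos:
  assumes "set_pmf p = {1..m}" "e \<in> all_edges m"
  shows "edge_mass p e > 0"
  unfolding edge_mass_def
proof (rule prod_pos)
  fix v assume "v \<in> e"
  then have "v \<in> set_pmf p" using assms unfolding all_edges_def by auto
  then show "pmf p v > 0" by (simp add: pmf_positive)
qed

text \<open>
  The tree-independent ratio of the two unnormalised weights. The division by \<open>a\<close> reflects that a tree
  has only \<open>m - 1\<close> edges.
\<close>

definition weight_const :: "nat \<Rightarrow> real \<Rightarrow> nat pmf \<Rightarrow> real" where
  "weight_const m a p = exp (- (\<Sum>e\<in>all_edges m. a * edge_mass p e)) * (\<Prod>u\<in>{1..m}. a * pmf p u) / a"

lemma graph_weight_compatible:
  assumes t: "t \<in> ordered_trees m" and G: "G \<in> compatible_graphs m t"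
    and p: "set_pmf p = {1..m}" and a: "a > 0"
  shows "graph_weight m a p G * pmf p (root t) =
    weight_const m a p * (\<Prod>v\<in>{1..m}. pmf p v ^ length (children t v)) * tilt m a p t * nu_per m a p t G"
proof -
  define T where "T = tree_edges t"
  define Q where "Q = permitted_edges m t"
  define E where "E = all_edges m"
  define x where "x e = a * edge_mass p e" for e
  define q where "q e = edge_prob a p e" for e
  have disj: "T \<inter> Q = {}" and sub: "T \<subseteq> E" "Q \<subseteq> E" and GT: "T \<subseteq> G" "G \<subseteq> T \<union> Q"
    using tree_permitted_disjoint[OF t] tree_edges_subset[OF t] permitted_edges_subset[OF t] G
    unfolding T_def Q_def E_def compatible_graphs_def by auto
  have fin: "finite E" "finite T" "finite Q"
    using sub finite_subset finite_all_edges unfolding E_def by blast+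
  have one_minus: "1 - q e = exp (- x e)" for e
    unfolding q_def x_def edge_prob_def by simp
  \<comment> \<open>Dividing and multiplying by \<open>x e\<close> separates the tilting factor from the \<open>p\<close>-tree weight.\<close>
  have q_tree: "q e = (exp (x e) - 1) / x e * x e * exp (- x e)" if "e \<in> T" for e
  proof -
    have "x e > 0" using edge_mass_pos[OF p] that sub a unfolding x_def E_def by auto
    then have "(exp (x e) - 1) / x e * x e = exp (x e) - 1" by simp
    moreover have "exp (x e) * exp (- x e) = 1" by (simp add: exp_minus)
    ultimately show ?thesis
      using one_minus[of e] by (simp add: left_diff_distrib)
  qed
  have present: "(\<Prod>e\<in>G. q e) = (\<Prod>e\<in>T. q e) * (\<Prod>e\<in>Q \<inter> G. q e)"
  proof -
    have "G = T \<union> (Q \<inter> G)" using GT by blast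
    then show ?thesis
      using prod.union_disjoint[of T "Q \<inter> G" q] fin disj by (metis finite_Int inf_assoc inf_bot_left)
  qed
  have absent: "(\<Prod>e\<in>E - G. 1 - q e) = (\<Prod>e\<in>Q - G. 1 - q e) * (\<Prod>e\<in>E - (T \<union> Q). 1 - q e)"
  proof -
    have "E - G = (Q - G) \<union> (E - (T \<union> Q))" using GT sub disj by blast
    then show ?thesis
      using prod.union_disjoint[of "Q - G" "E - (T \<union> Q)" "\<lambda>e. 1 - q e"] fin by auto
  qed
  have tree: "(\<Prod>e\<in>T. q e) =
      (\<Prod>e\<in>T. (exp (x e) - 1) / x e) * (\<Prod>e\<in>T. x e) * exp (- (\<Sum>e\<in>T. x e))"
  proof -
    have "(\<Prod>e\<in>T. q e) = (\<Prod>e\<in>T. (exp (x e) - 1) / x e * x e * exp (- x e))"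
      by (rule prod.cong[OF refl q_tree])
    also have "\<dots> = (\<Prod>e\<in>T. (exp (x e) - 1) / x e) * (\<Prod>e\<in>T. x e) * exp (- (\<Sum>e\<in>T. x e))"
      by (simp only: prod.distrib exp_sum[OF fin(2)] sum_negf[symmetric])
    finally show ?thesis .
  qed
  have rest: "(\<Prod>e\<in>E - (T \<union> Q). 1 - q e) = exp (- (\<Sum>e\<in>E - (T \<union> Q). x e))"
    using fin by (simp add: one_minus exp_sum sum_negf[symmetric])
  \<comment> \<open>The exponentials of tree edges and of non-permitted pairs are those of all pairs except the
    permitted ones; this is how the exponential factor of the tilting arises.\<close>
  have total: "(\<Sum>e\<in>E. x e) = (\<Sum>e\<in>T. x e) + (\<Sum>e\<in>Q. x e) + (\<Sum>e\<in>E - (T \<union> Q). x e)"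
    using sum.subset_diff[of "T \<union> Q" E x] sum.union_disjoint[of T Q x] fin sub disj by simp
  have exps: "exp (- (\<Sum>e\<in>T. x e)) * exp (- (\<Sum>e\<in>E - (T \<union> Q). x e)) =
      exp (- (\<Sum>e\<in>E. x e)) * exp (\<Sum>e\<in>Q. x e)"
    unfolding total exp_add[symmetric] by simp
  have mass: "(\<Prod>e\<in>T. x e) * pmf p (root t) =
      (\<Prod>v\<in>{1..m}. pmf p v ^ length (children t v)) * (\<Prod>u\<in>{1..m}. a * pmf p u) / a"
    using prod_tree_edge_mass[OF t, of a p] a unfolding T_def x_def by (simp add: field_simps)
  have per: "nu_per m a p t G = (\<Prod>e\<in>Q \<inter> G. q e) * (\<Prod>e\<in>Q - G. 1 - q e)"
    using G unfolding nu_per_def Q_def q_def by simp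
  have "graph_weight m a p G * pmf p (root t) =
      (\<Prod>e\<in>T. (exp (x e) - 1) / x e) * ((\<Prod>e\<in>T. x e) * pmf p (root t)) *
      (exp (- (\<Sum>e\<in>T. x e)) * exp (- (\<Sum>e\<in>E - (T \<union> Q). x e))) * nu_per m a p t G"
    unfolding graph_weight_def q_def[symmetric] E_def[symmetric] present absent tree rest per
    by (simp only: ac_simps)
  also have "\<dots> = weight_const m a p * (\<Prod>v\<in>{1..m}. pmf p v ^ length (children t v)) *
      tilt m a p t * nu_per m a p t G"
    unfolding mass exps weight_const_def tilt_def T_def[symmetric] Q_def[symmetric]
      E_def[symmetric] x_def[symmetric] by (simp add: ac_simps)
  finally show ?thesis .
qed

lemma graph_weight_nu_dfs:
  assumes t: "t \<in> ordered_trees m" and G: "G \<in> connected_graphs m"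
    and p: "set_pmf p = {1..m}" and a: "a > 0"
  shows "graph_weight m a p G * nu_dfs m p G t =
    weight_const m a p * (P_ord m p t * tilt m a p t * nu_per m a p t G)"
proof (cases "G \<in> compatible_graphs m t")
  case True
  have "P_ord m p t = (\<Prod>v\<in>{1..m}. pmf p v ^ length (children t v)) *
      (\<Prod>v\<in>{1..m}. 1 / fact (length (children t v)))"
    unfolding P_ord_def prod.distrib[symmetric] by simp
  then show ?thesis
    using graph_weight_compatible[OF t True p a] True
    by (simp add: nu_dfs_eq[OF t G] mult.assoc[symmetric])
next
  case False
  then show ?thesis by (simp add: nu_dfs_eq[OF t G] nu_per_def)
qed

section \<open>Normalisation\<close>

theorem proposition7p4:
  fixes m :: nat and a :: real and p :: "nat pmf"
  assumes "m \<ge> 1"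
    and "set_pmf p = {1..m}"
    and "a > 0"
  shows "(\<forall>G\<in>connected_graphs m. \<forall>t\<in>ordered_trees m.
            P_con m a p G * nu_dfs m p G t = P_ord_tilted m a p t * nu_per m a p t G) \<and>
         (\<forall>G\<in>connected_graphs m.
            P_con m a p G = (\<Sum>t\<in>ordered_trees m. P_ord_tilted m a p t * nu_per m a p t G))"
proof -
  define C where "C = weight_const m a p"
  define w where "w t = P_ord m p t * tilt m a p t" for t
  have joint: "graph_weight m a p G * nu_dfs m p G t = C * (w t * nu_per m a p t G)"
    if "G \<in> connected_graphs m" "t \<in> ordered_trees m" for G t
    using graph_weight_nu_dfs[OF that(2,1) assms(2,3)] by (simp add: C_def w_def)
  have "pmf p u > 0" if "u \<in> {1..m}" for u
    using that assms(2) by (simp add: pmf_positive)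
  then have "C \<noteq> 0"
    using assms(3) unfolding C_def weight_const_def by force
  have marginal: "graph_weight m a p G = C * (\<Sum>t\<in>ordered_trees m. w t * nu_per m a p t G)"
    if G: "G \<in> connected_graphs m" for G
  proof -
    have "graph_weight m a p G = (\<Sum>t\<in>ordered_trees m. graph_weight m a p G * nu_dfs m p G t)"
      using sum_nu_dfs[OF G assms(2)] by (simp add: sum_distrib_left[symmetric])
    also have "\<dots> = C * (\<Sum>t\<in>ordered_trees m. w t * nu_per m a p t G)"
      using joint[OF G] by (simp add: sum_distrib_left)
    finally show ?thesis .
  qed
  have "(\<Sum>G\<in>connected_graphs m. graph_weight m a p G) =
      C * (\<Sum>G\<in>connected_graphs m. \<Sum>t\<in>ordered_trees m. w t * nu_per m a p t G)"
    by (simp add: marginal sum_distrib_left)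
  also have "(\<Sum>G\<in>connected_graphs m. \<Sum>t\<in>ordered_trees m. w t * nu_per m a p t G) =
      (\<Sum>t\<in>ordered_trees m. w t * (\<Sum>G\<in>connected_graphs m. nu_per m a p t G))"
    by (subst sum.swap) (simp add: sum_distrib_left)
  also have "\<dots> = E_ord m p (tilt m a p)"
    unfolding E_ord_def w_def by (simp add: sum_nu_per)
  finally have Z: "(\<Sum>G\<in>connected_graphs m. graph_weight m a p G) = C * E_ord m p (tilt m a p)" .
  have first: "P_con m a p G * nu_dfs m p G t = P_ord_tilted m a p t * nu_per m a p t G"
    if "G \<in> connected_graphs m" "t \<in> ordered_trees m" for G t
  proof -
    have "P_con m a p G * nu_dfs m p G t =
        graph_weight m a p G * nu_dfs m p G t / (C * E_ord m p (tilt m a p))"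
      unfolding P_con_def Z by simp
    also have "\<dots> = w t * nu_per m a p t G / E_ord m p (tilt m a p)"
      unfolding joint[OF that] using \<open>C \<noteq> 0\<close> by simp
    finally show ?thesis
      unfolding P_ord_tilted_def w_def by simp
  qed
  have "P_con m a p G = (\<Sum>t\<in>ordered_trees m. P_ord_tilted m a p t * nu_per m a p t G)"
    if G: "G \<in> connected_graphs m" for G
  proof -
    have "P_con m a p G = (\<Sum>t\<in>ordered_trees m. P_con m a p G * nu_dfs m p G t)"
      using sum_nu_dfs[OF G assms(2)] by (simp add: sum_distrib_left[symmetric])
    then show ?thesis using first[OF G] by simp
  qed
  then show ?thesis using first by blast
qed

end
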